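(* Let $n,p\ge 1$ be integers, let $N:\mathbb R^p\to[0,\infty)$ be a norm with dual norm $N_\circ$, let $\mathbb X\in\mathbb R^{n\times p}$, and for every $\mathbf y\in\mathbb R^n$ let $\hat{\boldsymbol\beta}(\mathbf y)$ be a solution of $$\hat{\boldsymbol\beta}(\mathbf y)\in\operatorname*{argmin}_{\boldsymbol\beta\in\mathbb R^p}\left(\|\mathbf y-\mathbb X\boldsymbol\beta\|^2+2N(\boldsymbol\beta)\right).$$ Let $C=\{\mathbf u\in\mathbb R^n:\ N_\circ(\mathbb X^T\mathbf u)\le n\}$, a closed convex set, and let $P_C:\mathbb R^n\to C$ be the (Euclidean) projection onto $C$. Then: (i) $\mathbb X\hat{\boldsymbol\beta}(\mathbf y)=\mathbf y-P_C(\mathbf y)$ for all $\mathbf y\in\mathbb R^n$; (ii) the function $\hat{\boldsymbol\mu}(\mathbf y)=\mathbb X\hat{\boldsymbol\beta}(\mathbf y)$ satisfies, for all $\mathbf y,\mathbf y'\in\mathbb R^n$, $$\|\hat{\boldsymbol\mu}(\mathbf y)-\hat{\boldsymbol\mu}(\mathbf y')\|^2\le\|\mathbf y-\mathbf y'\|^2-\frac1n|P_C(\mathbf y)-P_C(\mathbf y')|_2^2 .$$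
   Context: For $\mathbf u\in\mathbb R^n$, $|\mathbf u|_2=(\sum_i u_i^2)^{1/2}$ is the Euclidean norm and $\|\mathbf u\|$ is the scaled Euclidean norm, $\|\mathbf u\|^2=\frac1n\sum_{i=1}^n u_i^2$. The dual norm is $N_\circ(\mathbf u)=\sup_{\mathbf v\in\mathbb R^p:\,N(\mathbf v)=1}\mathbf u^T\mathbf v$ for $\mathbf u\in\mathbb R^p$. *)

theory Defs
  imports "HOL-Analysis.Analysis"
begin

definition is_norm :: "('a::real_vector \<Rightarrow> real) \<Rightarrow> bool" where
  "is_norm N \<longleftrightarrow>
     (\<forall>x. 0 \<le> N x) \<and>
     (\<forall>x. N x = 0 \<longleftrightarrow> x = 0) \<and>
     (\<forall>c x. N (c *\<^sub>R x) = \<bar>c\<bar> * N x) \<and>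
     (\<forall>x y. N (x + y) \<le> N x + N y)"

text \<open>The supremum below is the real-valued \<^const>\<open>Sup\<close>. If \<open>N\<close> is a norm, the set is
  nonempty (index types are nonempty) and bounded above (finite dimension), so this
  is the true supremum.\<close>

definition dual_norm :: "(real ^ 'p \<Rightarrow> real) \<Rightarrow> real ^ 'p \<Rightarrow> real" where
  "dual_norm N u = Sup {u \<bullet> v | v. N v = 1}"

definition scaled_norm :: "real ^ 'n \<Rightarrow> real" where
  "scaled_norm u = sqrt ((1 / real CARD('n)) * (\<Sum>i\<in>UNIV. (u $ i)\<^sup>2))"

end

theory Submission
  imports Defs
begin

text \<open>
  Set \<open>b = beta_hat y\<close> and \<open>u = y - X *v b\<close>. Comparing \<open>b\<close> with the points of the segment from \<open>b\<close>
  to an arbitrary \<open>v\<close> gives the first-order condition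
  \<open>u \<bullet> X *v (v - b) \<le> n * (N v - N b)\<close>. Taking \<open>v = b + w\<close> yields \<open>u \<bullet> X *v w \<le> n * N w\<close>, so
  \<open>u \<in> C\<close>; taking \<open>v = 0\<close> yields \<open>u \<bullet> X *v b \<ge> n * N b\<close>, so \<open>u\<close> maximises \<open>\<lambda>z. z \<bullet> X *v b\<close> over
  \<open>C\<close>. Since \<open>X *v b = y - u\<close>, this is the obtuse angle characterisation of the projection of \<open>y\<close>.
  The same angle condition makes the projection firmly nonexpansive, which is the second claim.
\<close>

lemma is_norm_convex:
  assumes "is_norm N"
  shows "convex_on UNIV N"
proof (intro convex_onI)
  fix t :: real and x y
  assume "0 < t" "t < 1"
  then show "N ((1 - t) *\<^sub>R x + t *\<^sub>R y) \<le> (1 - t) * N x + t * N y"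
    using assms unfolding is_norm_def by (smt (verit))
qed simp

lemma is_norm_continuous:
  fixes N :: "'a::euclidean_space \<Rightarrow> real"
  assumes "is_norm N"
  shows "continuous_on UNIV N"
  using is_norm_convex[OF assms] by (intro convex_on_continuous) auto

text \<open>By compactness the continuous function \<open>N\<close> attains a minimum on the
  Euclidean unit sphere. It is positive by definiteness, and homogeneity carries the bound to all
  vectors.\<close>

lemma norm_le_is_norm:
  fixes N :: "'a::euclidean_space \<Rightarrow> real"
  assumes "is_norm N"
  obtains c where "c > 0" "\<And>v. norm v \<le> c * N v"
proof -
  have "continuous_on (sphere 0 1) N"
    using is_norm_continuous[OF assms] continuous_on_subset by blast
  then obtain x where x: "x \<in> sphere 0 1" "\<And>y. y \<in> sphere 0 1 \<Longrightarrow> N x \<le> N y"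
    using continuous_attains_inf[of "sphere (0::'a) 1" N] by auto
  have pos: "N x > 0"
    using x(1) assms unfolding is_norm_def by (metis less_eq_real_def mem_sphere_0 norm_zero zero_neq_one)
  have "norm v \<le> (1 / N x) * N v" for v
  proof (cases "v = 0")
    case False
    then have "N x \<le> N ((1 / norm v) *\<^sub>R v)"
      by (intro x(2)) simp
    also have "\<dots> = N v / norm v"
      using assms by (simp add: is_norm_def)
    finally show ?thesis
      using False pos by (simp add: field_simps)
  qed (use assms in \<open>simp add: is_norm_def\<close>)
  with pos show thesis
    by (intro that[of "1 / N x"]) auto
qed

text \<open>This trades the supremum for linear inequalities. The set is nonempty and bounded above,
  so \<open>Sup\<close> is a true least upper bound; homogeneity then passes from
  \<open>N v = 1\<close> to every \<open>v\<close>.\<close>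

lemma dual_norm_le_iff:
  fixes N :: "real ^ 'p \<Rightarrow> real"
  assumes "is_norm N"
  shows "dual_norm N u \<le> r \<longleftrightarrow> (\<forall>v. u \<bullet> v \<le> r * N v)"
proof -
  let ?S = "{u \<bullet> v | v. N v = 1}"
  have zero: "N v = 0 \<longleftrightarrow> v = 0" and nonneg: "N v \<ge> 0"
    and scale: "N (c *\<^sub>R v) = \<bar>c\<bar> * N v" for v c
    using assms by (auto simp: is_norm_def)
  have unit: "N ((1 / N v) *\<^sub>R v) = 1" if "v \<noteq> 0" for v
    using that zero[of v] nonneg[of v] by (simp add: scale)
  \<comment> \<open>The all-ones vector \<open>1\<close> is nonzero, so rescaling it gives a vector
    with \<open>N v = 1\<close>.\<close>
  have "?S \<noteq> {}"
    using unit[of 1] by auto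
  moreover have "bdd_above ?S"
  proof -
    obtain c where c: "\<And>v. norm v \<le> c * N v"
      using norm_le_is_norm[OF assms] by blast
    have "u \<bullet> v \<le> norm u * c" if "N v = 1" for v
      using norm_cauchy_schwarz[of u v] mult_left_mono[OF c[of v], of "norm u"] that by simp
    then show ?thesis
      by (intro bdd_aboveI[of _ "norm u * c"]) auto
  qed
  ultimately have "dual_norm N u \<le> r \<longleftrightarrow> (\<forall>v. N v = 1 \<longrightarrow> u \<bullet> v \<le> r)"
    unfolding dual_norm_def by (subst cSup_le_iff) auto
  also have "\<dots> \<longleftrightarrow> (\<forall>v. u \<bullet> v \<le> r * N v)"
  proof (intro iffI allI impI)
    fix v assume r: "\<forall>v. N v = 1 \<longrightarrow> u \<bullet> v \<le> r"
    show "u \<bullet> v \<le> r * N v"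
    proof (cases "v = 0")
      case False
      then have "u \<bullet> ((1 / N v) *\<^sub>R v) \<le> r"
        using r unit by blast
      then show ?thesis
        using False zero[of v] nonneg[of v] by (simp add: field_simps)
    qed (use zero[of 0] in simp)
  next
    fix v assume "\<forall>v. u \<bullet> v \<le> r * N v" "N v = 1"
    then show "u \<bullet> v \<le> r"
      by (metis mult.right_neutral)
  qed
  finally show ?thesis .
qed

lemma dual_norm_transpose_le_iff:
  fixes N :: "real ^ 'p \<Rightarrow> real" and X :: "real ^ 'p ^ 'n"
  assumes "is_norm N"
  shows "dual_norm N (transpose X *v u) \<le> r \<longleftrightarrow> (\<forall>v. u \<bullet> (X *v v) \<le> r * N v)"
  by (simp add: dual_norm_le_iff[OF assms] dot_lmul_matrix flip: vector_transpose_matrix)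

lemma scaled_norm_power2:
  fixes u :: "real ^ 'n"
  shows "(scaled_norm u)\<^sup>2 = (norm u)\<^sup>2 / real CARD('n)"
  by (simp add: scaled_norm_def sum_nonneg norm_vec_def L2_set_def)

lemma first_order_condition:
  fixes f :: "'b::real_vector \<Rightarrow> real" and L :: "'b \<Rightarrow> 'a::real_inner"
  assumes f: "convex_on UNIV f" and L: "linear L"
    and min: "\<And>v. (norm (y - L b))\<^sup>2 + 2 * f b \<le> (norm (y - L v))\<^sup>2 + 2 * f v"
  shows "(y - L b) \<bullet> L (v - b) \<le> f v - f b"
proof -
  define u where "u = y - L b"
  define w where "w = L (v - b)"
  have le: "2 * (u \<bullet> w - (f v - f b)) \<le> t * (norm w)\<^sup>2" if t: "0 < t" "t < 1" for t
  proof -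
    let ?v = "(1 - t) *\<^sub>R b + t *\<^sub>R v"
    have "f ?v \<le> (1 - t) * f b + t * f v"
      using f t by (intro convex_onD) auto
    moreover have "y - L ?v = u - t *\<^sub>R w"
      using L by (simp add: u_def w_def linear_add linear_diff linear_scale algebra_simps)
    moreover have "(norm u)\<^sup>2 + 2 * f b \<le> (norm (y - L ?v))\<^sup>2 + 2 * f ?v"
      using min[of ?v] by (simp only: u_def)
    ultimately have "(norm u)\<^sup>2 + 2 * f b \<le> (norm (u - t *\<^sub>R w))\<^sup>2 + 2 * ((1 - t) * f b + t * f v)"
      by simp
    also have "(norm (u - t *\<^sub>R w))\<^sup>2 = (norm u)\<^sup>2 - 2 * t * (u \<bullet> w) + t * (t * (norm w)\<^sup>2)"
      unfolding power2_norm_eq_inner by (simp add: inner_diff inner_commute algebra_simps)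
    finally have "t * (2 * (u \<bullet> w - (f v - f b))) \<le> t * (t * (norm w)\<^sup>2)"
      by (simp add: algebra_simps)
    then show ?thesis
      using t by simp
  qed
  \<comment> \<open>The quadratic term still carries a factor \<open>t\<close> after the division by
    \<open>t\<close>, so it vanishes as \<open>t\<close> tends to 0 from the right.\<close>
  have "((\<lambda>t. t * (norm w)\<^sup>2) \<longlongrightarrow> 0 * (norm w)\<^sup>2) (at_right 0)"
    by (intro tendsto_intros)
  moreover have "\<forall>\<^sub>F t in at_right 0. 2 * (u \<bullet> w - (f v - f b)) \<le> t * (norm w)\<^sup>2"
    using le by (auto simp: eventually_at_right_field intro!: exI[of _ 1])
  ultimately have "2 * (u \<bullet> w - (f v - f b)) \<le> 0 * (norm w)\<^sup>2"
    by (intro tendsto_lowerbound) auto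
  then show ?thesis
    by (simp add: u_def w_def)
qed

text \<open>Expanding the square of \<open>y - z = (y - u) - (z - u)\<close>, the angle condition
  makes the cross term nonnegative, so no \<open>z\<close> in \<open>S\<close> is closer to
  \<open>y\<close> than \<open>u\<close>.\<close>

lemma closest_point_eqI:
  fixes S :: "'a::euclidean_space set"
  assumes "closed S" "convex S" "u \<in> S" and "\<And>z. z \<in> S \<Longrightarrow> (y - u) \<bullet> (z - u) \<le> 0"
  shows "closest_point S y = u"
proof -
  have "dist y u \<le> dist y z" if "z \<in> S" for z
  proof -
    have "(norm (y - z))\<^sup>2 = (norm (y - u))\<^sup>2 - 2 * ((y - u) \<bullet> (z - u)) + (norm (z - u))\<^sup>2"
      unfolding power2_norm_eq_inner by (simp add: inner_diff inner_commute)
    with assms(4)[OF that] have "(norm (y - u))\<^sup>2 \<le> (norm (y - z))\<^sup>2"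
      using zero_le_power2[of "norm (z - u)"] by linarith
    then show ?thesis
      by (simp add: dist_norm)
  qed
  with assms show ?thesis
    by (intro closest_point_unique[symmetric]) auto
qed

text \<open>With \<open>D = P x - P y\<close>, adding the angle conditions at \<open>x\<close> and
  at \<open>y\<close> gives \<open>(norm D)\<^sup>2 \<le> (x - y) \<bullet> D\<close>. Inserting
  this into the expansion of the square of \<open>(x - y) - D\<close> yields the bound.\<close>

lemma closest_point_firmly_nonexpansive:
  fixes S :: "'a::euclidean_space set"
  assumes "closed S" "convex S" "S \<noteq> {}"
  defines "P \<equiv> closest_point S"
  shows "(norm ((x - P x) - (y - P y)))\<^sup>2 \<le> (norm (x - y))\<^sup>2 - (norm (P x - P y))\<^sup>2"
proof -
  have "P z \<in> S" for z
    unfolding P_def using assms by (intro closest_point_in_set)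
  then have "(x - P x) \<bullet> (P y - P x) \<le> 0" "(y - P y) \<bullet> (P x - P y) \<le> 0"
    using assms closest_point_dot unfolding P_def by blast+
  then show ?thesis
    unfolding power2_norm_eq_inner by (simp add: inner_diff inner_commute)
qed

theorem proposition2:
  fixes N :: "real ^ 'p \<Rightarrow> real"
    and X :: "real ^ 'p ^ 'n"
    and beta_hat :: "real ^ 'n \<Rightarrow> real ^ 'p"
    and mu_hat :: "real ^ 'n \<Rightarrow> real ^ 'n"
    and C :: "(real ^ 'n) set"
  assumes "is_norm N"
    and "\<And>y. is_arg_min (\<lambda>\<beta>. (scaled_norm (y - X *v \<beta>))\<^sup>2 + 2 * N \<beta>) (\<lambda>\<beta>. True) (beta_hat y)"
    and "C = {u. dual_norm N (transpose X *v u) \<le> real CARD('n)}"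
    and "\<And>y. mu_hat y = X *v beta_hat y"
  shows "closed C \<and> convex C \<and>
    (\<forall>y. X *v beta_hat y = y - closest_point C y) \<and>
    (\<forall>y y'. (scaled_norm (mu_hat y - mu_hat y'))\<^sup>2
       \<le> (scaled_norm (y - y'))\<^sup>2
         - (1 / real CARD('n)) * (norm (closest_point C y - closest_point C y'))\<^sup>2)"
proof -
  define n where "n = real CARD('n)"
  have n: "n > 0"
    by (simp add: n_def)
  have N0: "N 0 = 0" and N_add: "N (v + w) \<le> N v + N w" for v w
    using assms(1) by (auto simp: is_norm_def)
  have mem: "u \<in> C \<longleftrightarrow> (\<forall>v. u \<bullet> (X *v v) \<le> n * N v)" for u
    by (simp only: assms(3) n_def dual_norm_transpose_le_iff[OF assms(1)] mem_Collect_eq)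
  \<comment> \<open>One closed half-space for each \<open>v\<close>: closedness and convexity of
    \<open>C\<close> both follow from this form.\<close>
  then have C_eq: "C = (\<Inter>v. {u. (X *v v) \<bullet> u \<le> n * N v})"
    by (auto simp: inner_commute)
  have closed: "closed C"
    unfolding C_eq by (intro closed_INT ballI closed_halfspace_le)
  have convex: "convex C"
    unfolding C_eq by (intro convex_INT convex_halfspace_le)
  have residual: "y - X *v beta_hat y \<in> C \<and> closest_point C y = y - X *v beta_hat y" for y
  proof -
    define b where "b = beta_hat y"
    \<comment> \<open>Multiplying the objective by \<open>n\<close> makes the loss Euclidean and the
      penalty \<open>n * N\<close>, which matches the bound \<open>n\<close> in the definition of
      \<open>C\<close>.\<close>
    have "(norm (y - X *v b))\<^sup>2 + 2 * (n * N b) \<le> (norm (y - X *v v))\<^sup>2 + 2 * (n * N v)" for v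
    proof -
      have "(norm (y - X *v b))\<^sup>2 / n + 2 * N b \<le> (norm (y - X *v v))\<^sup>2 / n + 2 * N v"
        using assms(2)[of y]
        by (simp add: is_arg_min_linorder scaled_norm_power2 b_def n_def)
      then show ?thesis
        using n mult_left_mono[of _ _ n] by (fastforce simp: distrib_left mult.left_commute)
    qed
    moreover have "convex_on UNIV (\<lambda>v. n * N v)"
      using n is_norm_convex[OF assms(1)] by (intro convex_on_cmul) auto
    ultimately have opt: "(y - X *v b) \<bullet> (X *v (v - b)) \<le> n * N v - n * N b" for v
      by (intro first_order_condition[where L = "(*v) X" and f = "\<lambda>v. n * N v"]) auto
    have in_C: "y - X *v b \<in> C"
      unfolding mem
    proof
      fix w
      have "(y - X *v b) \<bullet> (X *v w) \<le> n * (N (b + w) - N b)"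
        using opt[of "b + w"] by (simp add: algebra_simps)
      also have "\<dots> \<le> n * N w"
        using n N_add[of b w] by (intro mult_left_mono) auto
      finally show "(y - X *v b) \<bullet> (X *v w) \<le> n * N w" .
    qed
    have "(y - (y - X *v b)) \<bullet> (z - (y - X *v b)) \<le> 0" if "z \<in> C" for z
    proof -
      have "z \<bullet> (X *v b) \<le> n * N b"
        using that mem by blast
      also have "\<dots> \<le> (y - X *v b) \<bullet> (X *v b)"
        using opt[of 0] unfolding matrix_vector_mult_diff_distrib by (simp add: N0)
      finally show ?thesis
        by (simp add: inner_diff inner_commute)
    qed
    then show ?thesis
      using closest_point_eqI[OF closed convex in_C] in_C by (simp add: b_def)
  qed
  then have nonempty: "C \<noteq> {}" and fit: "X *v beta_hat y = y - closest_point C y" for y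
    by auto
  have "(scaled_norm (mu_hat y - mu_hat y'))\<^sup>2 \<le> (scaled_norm (y - y'))\<^sup>2
      - (1 / real CARD('n)) * (norm (closest_point C y - closest_point C y'))\<^sup>2" for y y'
    \<comment> \<open>By \<open>fit\<close>, the fitted values are the projection residuals
      \<open>y - closest_point C y\<close>; dividing by \<open>n\<close> returns to the scaled
      norm.\<close>
    using divide_right_mono[OF closest_point_firmly_nonexpansive[OF closed convex nonempty, of y y'], of n] n
    by (simp add: assms(4) fit scaled_norm_power2 n_def diff_divide_distrib)
  with closed convex fit show ?thesis
    by blast
qed

end
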